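(* Let $G$ be a finite simple undirected graph with at least five vertices, and let $a,b\colon V(G)\to\mathbb{Z}_{\ge 0}$. Let $H$ be a prescribed graph, let $T_1(G)\subseteq V(G)$ be the set of vertices of $G$ that belong to at least one (not necessarily induced) subgraph of $G$ isomorphic to $H$, and let $T_0(G)=V(G)\setminus T_1(G)$. For $u\in V(G)$ let $h(u)\in\{0,1\}$ be the unique index with $u\in T_{h(u)}(G)$. Suppose that $d_G(u)\ge a(u)+b(u)+h(u)$ for every $u\in V(G)$. Then $G$ admits an $(a,b)$-feasible partition whenever one of the following holds: (i) $\min\{a(u),b(u)\}\ge 1-h(u)$ for every $u\in V(G)$, and $H$ is a graph obtained from $K_4-e$ by adding a single new vertex joined to exactly two vertices of $K_4-e$; (ii) $\min\{a(u),b(u)\}\ge 2-h(u)$ for every $u\in V(G)$, and $H\cong K_{2,3}$.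
   Context: $K_4-e$ is the graph obtained from the complete graph $K_4$ by deleting one edge; $K_{2,3}$ is the complete bipartite graph with parts of sizes $2$ and $3$. For $u\in V(G)$ and $X\subseteq V(G)$, $d_G(u)$ is the degree of $u$ and $d_X(u)=|N_G(u)\cap X|$ is the number of neighbours of $u$ in $X$. A subset $X\subseteq V(G)$ is $f$-feasible (for $f\colon V(G)\to\mathbb{Z}_{\ge0}$) if $d_X(u)\ge f(u)$ for every $u\in X$. An $(a,b)$-feasible partition of $G$ is a pair $(A,B)$ of non-empty disjoint subsets of $V(G)$ with $A\cup B=V(G)$ such that $A$ is $a$-feasible and $B$ is $b$-feasible.
   Formalization: In (i), T_1(G) is the set of vertices in a copy of any of the three graphs obtained from K_4-e by adding a vertex joined to two vertices; with one fixed H the claim fails (wheel W_4 or K_{1,1,4}, a=1, b=d_G-1). *)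

theory Defs
  imports "Graph_Theory.Graph_Theory"
begin

text \<open>A finite simple undirected graph is a \<^locale>\<open>pair_graph\<close>: an edge joining \<open>u\<close> and \<open>v\<close> is
  the pair of arcs \<open>(u, v)\<close> and \<open>(v, u)\<close>, so the degree of a vertex is its \<^const>\<open>out_degree\<close>.\<close>

definition neighbours :: "'a pair_pre_digraph \<Rightarrow> 'a \<Rightarrow> 'a set" where
  "neighbours G u = {v. (u, v) \<in> parcs G}"

definition degree_into :: "'a pair_pre_digraph \<Rightarrow> 'a set \<Rightarrow> 'a \<Rightarrow> nat" where
  "degree_into G X u = card (neighbours G u \<inter> X)"

lemma out_degree_eq_card_neighbours: "out_degree (with_proj G) u = card (neighbours G u)"
proof -
  have "out_arcs (with_proj G) u = Pair u ` neighbours G u"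
    by (auto simp: out_arcs_def neighbours_def)
  then show ?thesis
    by (simp add: out_degree_def card_image inj_on_def)
qed

definition feasible :: "'a pair_pre_digraph \<Rightarrow> ('a \<Rightarrow> nat) \<Rightarrow> 'a set \<Rightarrow> bool" where
  "feasible G f X \<longleftrightarrow> X \<subseteq> pverts G \<and> (\<forall>u\<in>X. degree_into G X u \<ge> f u)"

definition feasible_partition ::
  "'a pair_pre_digraph \<Rightarrow> ('a \<Rightarrow> nat) \<Rightarrow> ('a \<Rightarrow> nat) \<Rightarrow> 'a set \<Rightarrow> 'a set \<Rightarrow> bool" where
  "feasible_partition G a b A B \<longleftrightarrow>
     A \<noteq> {} \<and> B \<noteq> {} \<and> A \<inter> B = {} \<and> A \<union> B = pverts G \<and> feasible G a A \<and> feasible G b B"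

text \<open>The prescribed graph is given by a set \<open>\<H>\<close> of graphs, because the description "a graph obtained
  from \<open>K\<^sub>4 - e\<close> by adding a vertex joined to exactly two vertices" has three isomorphism types and
  a vertex belongs to \<open>T\<^sub>1\<close> as soon as it lies in a copy of any of them. Taking the graphs
  in \<open>\<H>\<close> on vertex type \<^typ>\<open>nat\<close> loses no finite isomorphism type.
  Since the graphs in \<open>\<H>\<close> are symmetric, so is every subdigraph of \<open>G\<close> isomorphic to one of them;
  the subdigraphs \<open>S\<close> below are therefore exactly the (not necessarily induced) undirected copies.\<close>

definition T1 :: "nat pair_pre_digraph set \<Rightarrow> 'a pair_pre_digraph \<Rightarrow> 'a set" where
  "T1 \<H> G = {u \<in> pverts G. \<exists>H\<in>\<H>. \<exists>S :: 'a pair_pre_digraph.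
     subgraph (with_proj S) (with_proj G) \<and> digraph_iso (with_proj H) (with_proj S) \<and> u \<in> pverts S}"

definition T0 :: "nat pair_pre_digraph set \<Rightarrow> 'a pair_pre_digraph \<Rightarrow> 'a set" where
  "T0 \<H> G = pverts G - T1 \<H> G"

definition is_K4_minus_edge :: "'a pair_pre_digraph \<Rightarrow> bool" where
  "is_K4_minus_edge D \<longleftrightarrow> (\<exists>K u v. complete_digraph 4 (with_proj K) \<and> (u, v) \<in> parcs K \<and>
     D = \<lparr>pverts = pverts K, parcs = parcs K - {(u, v), (v, u)}\<rparr>)"

definition is_K4_minus_edge_plus_vertex :: "'a pair_pre_digraph \<Rightarrow> bool" where
  "is_K4_minus_edge_plus_vertex H \<longleftrightarrow> (\<exists>D x y z. is_K4_minus_edge D \<and>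
     x \<notin> pverts D \<and> y \<in> pverts D \<and> z \<in> pverts D \<and> y \<noteq> z \<and>
     H = \<lparr>pverts = insert x (pverts D), parcs = parcs D \<union> {(x, y), (y, x), (x, z), (z, x)}\<rparr>)"

end

theory Submission
  imports Defs
begin

text \<open>
  If disjoint non-empty sets, one \<open>a\<close>-feasible and one \<open>b\<close>-feasible, exist, then they extend to a feasible
  partition, so assume there are none; then \<open>a, b \<ge> 1\<close> everywhere. Following Stiebitz, consider the
  partitions \<open>(A, B)\<close> in which one side contains no non-empty feasible subset and the other
  contains no non-empty subset that is feasible with all demands raised by one, and maximize
  \<open>e(A) + e(B) + b(A) + a(B)\<close>. In an optimal partition exactly one side is feasible, say \<open>B\<close>; a vertex
  \<open>y \<in> B\<close> with only \<open>b y\<close> neighbours in \<open>B\<close> has degree exactly \<open>a y + b y\<close> (so \<open>h y = 0\<close>), and moving it to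
  \<open>A\<close> preserves optimality. If moreover \<open>|B|\<close> is minimal, this move makes \<open>A\<close> feasible. Hence all vertices \<open>y\<close>
  of this kind are adjacent to all \<open>x \<in> A\<close> with fewer than \<open>a x\<close> neighbours in \<open>A\<close>, each \<open>y\<close> is adjacent to another
  vertex \<open>z\<close> of its kind, and \<open>x\<close>, \<open>y\<close> may be exchanged.

  This produces a triangle \<open>xyz\<close> of vertices with \<open>h = 0\<close> and disjoint sets \<open>A, B\<close> covering the remaining
  vertices, such that \<open>A\<close> has no \<open>a\<close>-feasible and \<open>B\<close> no \<open>b\<close>-feasible non-empty subset. Every vertex of \<open>A\<close> or \<open>B\<close>
  violating its demand there has at least two neighbours in the triangle. If both \<open>A\<close> and \<open>B\<close> are
  non-empty, this yields two such vertices, and thereby a copy of \<open>H\<close> through the triangle. In case (i), if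
  \<open>A\<close> or \<open>B\<close> is empty, then two triangle vertices form a feasible set, and so do the vertices
  outside the triangle with at most one neighbour in it.
\<close>

section \<open>Counting neighbours inside a vertex set\<close>

context pair_graph
begin

lemma neighbours_subset: "neighbours G u \<subseteq> pverts G"
  by (auto simp: neighbours_def dest: in_arcsD2)

lemma finite_neighbours [simp]: "finite (neighbours G u)"
  using neighbours_subset pair_finite_verts by (rule finite_subset)

lemma neighbours_sym: "v \<in> neighbours G u \<longleftrightarrow> u \<in> neighbours G v"
  using pair_sym_arcs by (auto simp: neighbours_def dest: symD arcs_symmetric)

lemma not_self_neighbour [simp]: "u \<notin> neighbours G u"
  using pair_no_loops[of "(u, u)"] by (auto simp: neighbours_def)

lemma degree_into_insert:
  "v \<notin> X \<Longrightarrow> degree_into G (insert v X) u =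
     degree_into G X u + (if v \<in> neighbours G u then 1 else 0)"
  by (simp add: degree_into_def)

lemma degree_into_remove:
  "v \<in> X \<Longrightarrow> degree_into G X u =
     degree_into G (X - {v}) u + (if v \<in> neighbours G u then 1 else 0)"
  using degree_into_insert[of v "X - {v}" u] by (simp add: insert_absorb)

lemma degree_into_self [simp]:
  "degree_into G (insert u X) u = degree_into G X u" "degree_into G (X - {u}) u = degree_into G X u"
proof -
  have "neighbours G u \<inter> insert u X = neighbours G u \<inter> X"
    "neighbours G u \<inter> (X - {u}) = neighbours G u \<inter> X"
    by auto
  then show "degree_into G (insert u X) u = degree_into G X u"
    "degree_into G (X - {u}) u = degree_into G X u"
    by (simp_all add: degree_into_def)
qed

lemma degree_into_mono: "X \<subseteq> Y \<Longrightarrow> degree_into G X u \<le> degree_into G Y u"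
  unfolding degree_into_def by (rule card_mono) auto

lemma degree_into_Un:
  "X \<inter> Y = {} \<Longrightarrow> degree_into G (X \<union> Y) u = degree_into G X u + degree_into G Y u"
  unfolding degree_into_def by (subst Int_Un_distrib, rule card_Un_disjoint) auto

text \<open>Adjacency is symmetric, so the edges from \<open>v\<close> into \<open>X\<close> can be
  counted at their other ends. In \<open>weight_move\<close> this collects the edges at the moved
  vertex.\<close>

lemma degree_into_eq_sum:
  "finite X \<Longrightarrow> degree_into G X v = (\<Sum>u\<in>X. if v \<in> neighbours G u then 1 else 0)"
proof -
  assume X: "finite X"
  have "neighbours G v \<inter> X = {u \<in> X. v \<in> neighbours G u}"
    using neighbours_sym by auto
  then show ?thesis using X by (simp add: degree_into_def sum.If_cases Int_def)
qed

end

section \<open>Degenerate sets\<close>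

text \<open>For constant \<open>f = k + 1\<close> this is the usual \<open>k\<close>-degeneracy of
  the subgraph induced on \<open>X\<close>.\<close>

definition degenerate :: "'a pair_pre_digraph \<Rightarrow> ('a \<Rightarrow> nat) \<Rightarrow> 'a set \<Rightarrow> bool" where
  "degenerate G f X \<longleftrightarrow> (\<forall>Y. Y \<subseteq> X \<and> Y \<noteq> {} \<longrightarrow> (\<exists>u\<in>Y. degree_into G Y u < f u))"

lemma degenerate_mono: "degenerate G f X \<Longrightarrow> Y \<subseteq> X \<Longrightarrow> degenerate G f Y"
  unfolding degenerate_def by blast

lemma degenerateD: "degenerate G f X \<Longrightarrow> X \<noteq> {} \<Longrightarrow> \<exists>u\<in>X. degree_into G X u < f u"
  unfolding degenerate_def by blast

lemma degenerate_empty [simp]: "degenerate G f {}"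
  unfolding degenerate_def by blast

text \<open>Deleting \<open>y\<close> from \<open>Y\<close> costs each other vertex at most one
  neighbour; if nothing else is left, \<open>y\<close> itself has degree 0 in
  \<open>Y\<close>.\<close>

lemma (in pair_graph) degenerate_insert:
  assumes "degenerate G f X"
  shows "degenerate G (\<lambda>u. Suc (f u)) (insert y X)"
  unfolding degenerate_def
proof (intro allI impI)
  fix Y assume Y: "Y \<subseteq> insert y X \<and> Y \<noteq> {}"
  show "\<exists>u\<in>Y. degree_into G Y u < Suc (f u)"
  proof (cases "Y - {y} = {}")
    case True
    then have "Y = {y}" using Y by auto
    moreover have "degree_into G {y} y = 0" by (simp add: degree_into_def)
    ultimately show ?thesis by simp
  next
    case False
    then obtain u where u: "u \<in> Y - {y}" "degree_into G (Y - {y}) u < f u"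
      using assms Y unfolding degenerate_def by (metis Diff_subset_conv insert_is_Un)
    have "degree_into G Y u \<le> Suc (degree_into G (Y - {y}) u)"
      using degree_into_remove[of y Y u] by (cases "y \<in> Y") auto
    then show ?thesis using u by (intro bexI[of _ u]) auto
  qed
qed

text \<open>In a minimal non-degenerate set, removing any vertex leaves a degenerate one, and
  \<open>degenerate_insert\<close> puts it back.\<close>

lemma (in pair_graph) not_degenerate_minimal:
  assumes "finite X" "\<not> degenerate G f X"
  shows "\<exists>Y\<subseteq>X. \<not> degenerate G f Y \<and> degenerate G (\<lambda>u. Suc (f u)) Y"
  using assms
proof (induction X rule: finite_psubset_induct)
  case (psubset X)
  show ?case
  proof (cases "\<exists>u\<in>X. \<not> degenerate G f (X - {u})")
    case True
    then obtain u where u: "u \<in> X" "\<not> degenerate G f (X - {u})" by blast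
    then have "X - {u} \<subset> X" by blast
    from psubset.IH[OF this u(2)] show ?thesis by blast
  next
    case False
    obtain u where "u \<in> X"
      using psubset.prems by (metis all_not_in_conv degenerate_empty)
    then have "degenerate G (\<lambda>u. Suc (f u)) X"
      using False degenerate_insert[of f "X - {u}" u] by (simp add: insert_absorb)
    then show ?thesis using psubset.prems by blast
  qed
qed

lemma not_degenerate_feasible:
  assumes "\<not> degenerate G f X" "X \<subseteq> pverts G"
  shows "\<exists>Y\<subseteq>X. Y \<noteq> {} \<and> feasible G f Y"
  using assms unfolding degenerate_def feasible_def by (meson not_le subset_trans)

lemma feasible_not_degenerate:
  "feasible G f Y \<Longrightarrow> Y \<noteq> {} \<Longrightarrow> \<not> degenerate G f Y"
  unfolding degenerate_def feasible_def by (meson not_le order_refl)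

section \<open>Optimal partitions\<close>

text \<open>The situation of a counterexample with \<open>h\<close> forgotten: only vertices of
  degree exactly \<open>a u + b u\<close> will matter, and these have
  \<open>h u = 0\<close>.\<close>

locale no_feasible_pair = pair_graph G for G :: "'a pair_pre_digraph" +
  fixes a b :: "'a \<Rightarrow> nat"
  assumes a_pos: "u \<in> pverts G \<Longrightarrow> 1 \<le> a u"
    and b_pos: "u \<in> pverts G \<Longrightarrow> 1 \<le> b u"
    and degree_ge: "u \<in> pverts G \<Longrightarrow> a u + b u \<le> degree_into G (pverts G) u"
    and verts_nonempty: "pverts G \<noteq> {}"
    and no_pair: "\<lbrakk>X \<subseteq> pverts G; Y \<subseteq> pverts G; X \<inter> Y = {}\<rbrakk> \<Longrightarrow> degenerate G a X \<or> degenerate G b Y"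
begin

lemma swapped: "no_feasible_pair G b a"
proof unfold_locales
  show "degenerate G b X \<or> degenerate G a Y"
    if "X \<subseteq> pverts G" "Y \<subseteq> pverts G" "X \<inter> Y = {}" for X Y
    using that no_pair[of Y X] by blast
qed (use a_pos b_pos degree_ge verts_nonempty in \<open>auto simp: add.commute\<close>)

text \<open>Twice Stiebitz's weight \<open>e(A) + e(B) + b(A) + a(B)\<close>, up to the constant \<open>2 e(G)\<close>: counting the
  cut edges from both sides makes the definition symmetric under exchanging \<open>(a, A)\<close> with \<open>(b, B)\<close>.\<close>

definition weight :: "'a set \<Rightarrow> 'a set \<Rightarrow> int" where
  "weight A B = 2 * (\<Sum>u\<in>A. int (b u)) + 2 * (\<Sum>u\<in>B. int (a u))
     - (\<Sum>u\<in>A. int (degree_into G B u)) - (\<Sum>u\<in>B. int (degree_into G A u))"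

definition degenerate_partition :: "'a set \<Rightarrow> 'a set \<Rightarrow> bool" where
  "degenerate_partition A B \<longleftrightarrow> A \<inter> B = {} \<and> A \<union> B = pverts G \<and>
     (degenerate G a A \<and> degenerate G (\<lambda>u. Suc (b u)) B \<or>
      degenerate G (\<lambda>u. Suc (a u)) A \<and> degenerate G b B)"

definition optimal :: "'a set \<Rightarrow> 'a set \<Rightarrow> bool" where
  "optimal A B \<longleftrightarrow> degenerate_partition A B \<and>
     (\<forall>A' B'. degenerate_partition A' B' \<longrightarrow> weight A' B' \<le> weight A B)"

text \<open>The heavy side is the one with raised demands. A partition may be heavy on both sides as
  far as the definitions go; feasibility of the heavy side excludes this.\<close>

definition right_heavy :: "'a set \<Rightarrow> 'a set \<Rightarrow> bool" where
  "right_heavy A B \<longleftrightarrow> optimal A B \<and> degenerate G a A \<and> degenerate G (\<lambda>u. Suc (b u)) B"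

definition left_heavy :: "'a set \<Rightarrow> 'a set \<Rightarrow> bool" where
  "left_heavy A B \<longleftrightarrow> optimal A B \<and> degenerate G (\<lambda>u. Suc (a u)) A \<and> degenerate G b B"

lemma optimal_cases: "optimal A B \<Longrightarrow> right_heavy A B \<or> left_heavy A B"
  unfolding optimal_def degenerate_partition_def right_heavy_def left_heavy_def by blast

lemma optimal_partition: "optimal A B \<Longrightarrow> A \<inter> B = {} \<and> A \<union> B = pverts G \<and> finite A \<and> finite B"
  unfolding optimal_def degenerate_partition_def
  using pair_finite_verts by (metis finite_Un)

text \<open>Lets each statement about the left side be read off from its mirror image on the
  right.\<close>

lemma swapped_defs:
  "no_feasible_pair.optimal G b a B A \<longleftrightarrow> optimal A B"
  "no_feasible_pair.right_heavy G b a B A \<longleftrightarrow> left_heavy A B"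
  "no_feasible_pair.left_heavy G b a B A \<longleftrightarrow> right_heavy A B"
proof -
  interpret sw: no_feasible_pair G b a by (rule swapped)
  have w: "sw.weight B A = weight A B" for A B
    by (simp add: weight_def sw.weight_def)
  have d: "sw.degenerate_partition B A \<longleftrightarrow> degenerate_partition A B" for A B
    unfolding degenerate_partition_def sw.degenerate_partition_def by (auto simp: Int_commute Un_commute)
  have o: "sw.optimal B A \<longleftrightarrow> optimal A B" for A B
    unfolding optimal_def sw.optimal_def by (auto simp: w d)
  show "sw.optimal B A \<longleftrightarrow> optimal A B" by (rule o)
  show "sw.right_heavy B A \<longleftrightarrow> left_heavy A B" "sw.left_heavy B A \<longleftrightarrow> right_heavy A B"
    unfolding right_heavy_def sw.right_heavy_def left_heavy_def sw.left_heavy_def by (auto simp: o)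
qed

lemma degree_split:
  assumes "A \<inter> B = {}" "A \<union> B = pverts G" "u \<in> pverts G"
  shows "a u + b u \<le> degree_into G A u + degree_into G B u"
  using degree_ge[of u] degree_into_Un[of A B u] assms by simp

text \<open>The neighbours of \<open>y\<close> in \<open>A\<close> leave the cut and those in
  \<open>B\<close> enter it, each cut edge being counted from both ends.\<close>

lemma weight_move:
  assumes "A \<inter> B = {}" "finite A" "finite B" "y \<in> B"
  shows "weight (insert y A) (B - {y}) = weight A B
    + 2 * (int (b y) - int (a y) + int (degree_into G A y) - int (degree_into G B y))"
proof -
  define C where "C = B - {y}"
  have B: "B = insert y C" "y \<notin> C" "finite C" and y: "y \<notin> A"
    using assms by (auto simp: C_def)
  have sA: "(\<Sum>u\<in>A. int (degree_into G B u)) = (\<Sum>u\<in>A. int (degree_into G C u)) + int (degree_into G A y)"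
    using B(1,2) \<open>finite A\<close>
    by (simp add: degree_into_insert degree_into_eq_sum[of A] sum.distrib[symmetric] if_distrib add.commute cong: if_cong)
  have sC: "(\<Sum>u\<in>C. int (degree_into G (insert y A) u))
      = (\<Sum>u\<in>C. int (degree_into G A u)) + int (degree_into G C y)"
    using y B(3)
    by (simp add: degree_into_insert degree_into_eq_sum[of C] sum.distrib[symmetric] if_distrib add.commute cong: if_cong)
  have "degree_into G B y = degree_into G C y" using B by simp
  moreover have "B - {y} = C" by (simp add: C_def)
  ultimately show ?thesis
    using sA sC B(2,3) y \<open>finite A\<close> unfolding weight_def by (simp add: B(1))
qed

text \<open>The move yields an admissible partition, so optimality bounds its change of weight.
  Together with the degree condition and the assumption on \<open>y\<close> this forces equality
  throughout, and the weight does not change.\<close>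

lemma right_heavy_move:
  assumes "right_heavy A B" "y \<in> B" "degree_into G B y \<le> b y"
  shows "degree_into G B y = b y" "degree_into G A y = a y" "optimal (insert y A) (B - {y})"
proof -
  have opt: "optimal A B" and dA: "degenerate G a A" and dB: "degenerate G (\<lambda>u. Suc (b u)) B"
    using assms(1) by (auto simp: right_heavy_def)
  note p = optimal_partition[OF opt]
  have p': "insert y A \<inter> (B - {y}) = {}" "insert y A \<union> (B - {y}) = pverts G"
    using p assms(2) by auto
  have "degenerate G (\<lambda>u. Suc (b u)) (B - {y})" using dB by (rule degenerate_mono) auto
  moreover have "degenerate G (\<lambda>u. Suc (a u)) (insert y A)" by (rule degenerate_insert[OF dA])
  \<comment> \<open>Both sides are degenerate for raised demands; this removes the raise on one of
    them, as an admissible partition requires.\<close>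
  moreover have "degenerate G a (insert y A) \<or> degenerate G b (B - {y})"
    using p' by (intro no_pair) auto
  ultimately have dp: "degenerate_partition (insert y A) (B - {y})"
    unfolding degenerate_partition_def using p' by blast
  then have "weight (insert y A) (B - {y}) \<le> weight A B"
    using opt by (simp add: optimal_def)
  moreover have wm: "weight (insert y A) (B - {y}) = weight A B
    + 2 * (int (b y) - int (a y) + int (degree_into G A y) - int (degree_into G B y))"
    using p assms(2) by (intro weight_move) auto
  moreover have "a y + b y \<le> degree_into G A y + degree_into G B y"
    using p assms(2) by (intro degree_split) auto
  ultimately have le: "degree_into G A y + b y \<le> a y + degree_into G B y"
    "a y + b y \<le> degree_into G A y + degree_into G B y"
    by simp_all
  from le show eq: "degree_into G B y = b y" "degree_into G A y = a y"
    using assms(3) by simp_all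
  show "optimal (insert y A) (B - {y})"
    using opt dp wm eq unfolding optimal_def by simp
qed

lemma left_heavy_move:
  assumes "left_heavy A B" "x \<in> A" "degree_into G A x \<le> a x"
  shows "degree_into G A x = a x" "degree_into G B x = b x" "optimal (A - {x}) (insert x B)"
  using no_feasible_pair.right_heavy_move[OF swapped, of B A x] assms by (auto simp: swapped_defs)

text \<open>A vertex with fewer than \<open>b y\<close> neighbours in \<open>B\<close> would satisfy
  the premise of \<open>right_heavy_move\<close>, which then gives it exactly
  \<open>b y\<close>.\<close>

lemma right_heavy_feasible:
  assumes "right_heavy A B"
  shows "feasible G b B"
proof -
  have "B \<subseteq> pverts G" using assms optimal_partition by (auto simp: right_heavy_def)
  moreover have "b y \<le> degree_into G B y" if "y \<in> B" for y
    using right_heavy_move(1)[OF assms that] by linarith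
  ultimately show ?thesis by (simp add: feasible_def)
qed

lemma left_heavy_feasible: "left_heavy A B \<Longrightarrow> feasible G a A"
  using no_feasible_pair.right_heavy_feasible[OF swapped, of B A] by (simp add: swapped_defs)

lemma verts_not_degenerate: "\<not> degenerate G a (pverts G)"
proof -
  have "feasible G a (pverts G)"
    unfolding feasible_def using degree_ge by (meson add_leD1 order_refl)
  then show ?thesis using feasible_not_degenerate verts_nonempty by blast
qed

text \<open>\<open>B\<close> is non-empty because the whole vertex set is not degenerate for
  \<open>a\<close>; degeneracy for the raised demands then provides the vertex.\<close>

lemma right_heavy_tight_vertex:
  assumes "right_heavy A B"
  obtains y where "y \<in> B" "degree_into G B y = b y"
proof -
  have d: "degenerate G a A" "degenerate G (\<lambda>u. Suc (b u)) B" and p: "A \<union> B = pverts G"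
    using assms optimal_partition by (auto simp: right_heavy_def)
  have "B \<noteq> {}" using d(1) p verts_not_degenerate by auto
  then obtain y where "y \<in> B" "degree_into G B y \<le> b y"
    using degenerateD[OF d(2)] by (auto simp: less_Suc_eq_le)
  then show ?thesis using right_heavy_move(1)[OF assms] that by blast
qed

lemma left_heavy_tight_vertex:
  assumes "left_heavy A B"
  obtains x where "x \<in> A" "degree_into G A x = a x"
  using no_feasible_pair.right_heavy_tight_vertex[OF swapped, of B A] assms that
  by (auto simp: swapped_defs)

lemma optimal_exists: "\<exists>A B. optimal A B"
proof -
  let ?S = "{(A, B). degenerate_partition A B}"
  \<comment> \<open>A minimal non-degenerate set and its complement form a first admissible
    partition; there are only finitely many to maximize over.\<close>
  obtain X where X: "X \<subseteq> pverts G" "\<not> degenerate G a X" "degenerate G (\<lambda>u. Suc (a u)) X"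
    using not_degenerate_minimal[OF pair_finite_verts verts_not_degenerate] by blast
  then have "degenerate G b (pverts G - X)" using no_pair[of X "pverts G - X"] by blast
  then have "(X, pverts G - X) \<in> ?S" using X by (auto simp: degenerate_partition_def)
  moreover have fin: "finite ?S"
  proof (rule finite_subset)
    show "?S \<subseteq> Pow (pverts G) \<times> Pow (pverts G)" by (auto simp: degenerate_partition_def)
  qed (simp add: pair_finite_verts)
  ultimately obtain P where P: "P \<in> ?S" "Max (case_prod weight ` ?S) = case_prod weight P"
    by (metis (no_types, lifting) Max_in empty_iff empty_is_image finite_imageI imageE)
  then have "case_prod weight Q \<le> case_prod weight P" if "Q \<in> ?S" for Q
    using that fin by (metis Max_ge finite_imageI imageI)
  then have "optimal (fst P) (snd P)" using P(1) unfolding optimal_def by (force split: prod.splits)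
  then show ?thesis by blast
qed

text \<open>If every optimal partition were left heavy, a tight vertex could always be moved out of
  \<open>A\<close>, contradicting a choice with \<open>card A\<close> minimal.\<close>

lemma right_heavy_exists: "\<exists>A B. right_heavy A B"
proof (rule ccontr)
  assume none: "\<nexists>A B. right_heavy A B"
  have left: "optimal A B \<Longrightarrow> left_heavy A B" for A B using none optimal_cases by blast
  obtain P where P: "case_prod optimal P"
    and min: "\<And>Q. case_prod optimal Q \<Longrightarrow> card (fst P) \<le> card (fst Q)"
    using optimal_exists ex_has_least_nat[of "case_prod optimal" _ "\<lambda>P. card (fst P)"] by force
  obtain A B where AB: "P = (A, B)" by (cases P)
  have opt: "optimal A B" using P AB by simp
  obtain x where x: "x \<in> A" "degree_into G A x = a x"
    using left_heavy_tight_vertex[OF left[OF opt]] by blast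
  have "optimal (A - {x}) (insert x B)" using left_heavy_move(3)[OF left[OF opt]] x by simp
  then have "card A \<le> card (A - {x})" using min[of "(A - {x}, insert x B)"] AB by simp
  moreover have "finite A" using optimal_partition[OF opt] by blast
  ultimately show False using x(1) by (metis card_Diff1_less linorder_not_less)
qed

section \<open>Right-heavy partitions with smallest right side\<close>

definition extremal :: "'a set \<Rightarrow> 'a set \<Rightarrow> bool" where
  "extremal A B \<longleftrightarrow> right_heavy A B \<and> (\<forall>A' B'. right_heavy A' B' \<longrightarrow> card B \<le> card B')"

lemma extremal_exists: "\<exists>A B. extremal A B"
proof -
  obtain P where P: "case_prod right_heavy P"
    and min: "\<And>Q. case_prod right_heavy Q \<Longrightarrow> card (snd P) \<le> card (snd Q)"
    using right_heavy_exists ex_has_least_nat[of "case_prod right_heavy" _ "\<lambda>P. card (snd P)"] by force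
  have "extremal (fst P) (snd P)"
    unfolding extremal_def using P min by (force split: prod.splits)
  then show ?thesis by blast
qed

text \<open>The moved partition is again optimal, and its right side is too small for it to be right
  heavy.\<close>

lemma extremal_move:
  assumes "extremal A B" "y \<in> B" "degree_into G B y = b y"
  shows "left_heavy (insert y A) (B - {y})"
proof (rule ccontr)
  assume n: "\<not> left_heavy (insert y A) (B - {y})"
  have r: "right_heavy A B" using assms(1) by (simp add: extremal_def)
  have "optimal (insert y A) (B - {y})" using right_heavy_move(3)[OF r] assms by simp
  then have "right_heavy (insert y A) (B - {y})" using n optimal_cases by blast
  then have "card B \<le> card (B - {y})" using assms(1) by (auto simp: extremal_def)
  moreover have "finite B" using optimal_partition r by (auto simp: right_heavy_def)
  ultimately show False using assms(2) by (metis card_Diff1_less linorder_not_less)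
qed

lemma extremal_partition:
  "extremal A B \<Longrightarrow> A \<inter> B = {} \<and> A \<union> B = pverts G \<and> finite A \<and> finite B"
  using optimal_partition by (auto simp: extremal_def right_heavy_def)

text \<open>Moving \<open>y\<close> makes the left side feasible, so \<open>y\<close> must supply
  the one neighbour that \<open>x\<close> lacks. Then \<open>x\<close> is tight in the new left
  side, and \<open>left_heavy_move\<close> gives its degree on the right.\<close>

lemma extremal_deficient:
  assumes e: "extremal A B" and x: "x \<in> A" "degree_into G A x < a x"
    and y: "y \<in> B" "degree_into G B y = b y"
  shows "x \<in> neighbours G y" "Suc (degree_into G A x) = a x" "degree_into G B x = Suc (b x)"
proof -
  have l: "left_heavy (insert y A) (B - {y})" by (rule extremal_move[OF e y])
  have yA: "y \<notin> A" and xB: "x \<noteq> y" using extremal_partition[OF e] x y by auto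
  have "a x \<le> degree_into G (insert y A) x"
    using left_heavy_feasible[OF l] x by (simp add: feasible_def)
  then have 1: "y \<in> neighbours G x" "Suc (degree_into G A x) = a x"
    using x(2) degree_into_insert[OF yA, of x] by (auto split: if_splits)
  then show "x \<in> neighbours G y" "Suc (degree_into G A x) = a x" using neighbours_sym by auto
  have "degree_into G (insert y A) x \<le> a x" using 1 degree_into_insert[OF yA, of x] by simp
  then have "degree_into G (B - {y}) x = b x" using left_heavy_move(2)[OF l] x by simp
  then show "degree_into G B x = Suc (b x)" using degree_into_remove[OF y(1), of x] 1 by simp
qed

text \<open>Moving \<open>y\<close> to the left and then \<open>x\<close> to the right keeps the partition optimal, and \<open>y\<close>, having lost
  its neighbour \<open>x\<close>, prevents the left side from being feasible.\<close>

lemma extremal_swap: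
  assumes e: "extremal A B" and x: "x \<in> A" "degree_into G A x < a x"
    and y: "y \<in> B" "degree_into G B y = b y"
  shows "extremal (insert y (A - {x})) (insert x (B - {y}))"
proof -
  have l: "left_heavy (insert y A) (B - {y})" by (rule extremal_move[OF e y])
  have r: "right_heavy A B" using e by (simp add: extremal_def)
  have p: "y \<notin> A" "x \<notin> B" "x \<noteq> y" "finite B" using extremal_partition[OF e] x y by auto
  note d = extremal_deficient[OF e x y]
  have "degree_into G (insert y A) x = a x"
    using d degree_into_insert[OF p(1), of x] neighbours_sym by auto
  then have "optimal (insert y A - {x}) (insert x (B - {y}))"
    using left_heavy_move(3)[OF l, of x] x by simp
  moreover have eq: "insert y A - {x} = insert y (A - {x})" using p by auto
  ultimately have opt: "optimal (insert y (A - {x})) (insert x (B - {y}))" by simp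
  have "degree_into G A y = a y" using right_heavy_move(2)[OF r y(1)] y by simp
  then have "degree_into G (insert y (A - {x})) y < a y"
    using degree_into_remove[OF x(1), of y] d(1) by simp
  then have "\<not> left_heavy (insert y (A - {x})) (insert x (B - {y}))"
    using left_heavy_feasible by (force simp: feasible_def)
  then have "right_heavy (insert y (A - {x})) (insert x (B - {y}))" using opt optimal_cases by blast
  moreover have "card (insert x (B - {y})) = card B"
    using p y(1) by (metis Diff_iff card_Suc_Diff1 card_insert_disjoint finite_Diff)
  ultimately show ?thesis using e by (simp add: extremal_def)
qed

end

section \<open>The critical triangle\<close>

context pair_graph
begin

lemma degree_into_triple:
  assumes "distinct [x, y, z]"
  shows "2 \<le> degree_into G {x, y, z} u \<longleftrightarrow>
    x \<in> neighbours G u \<and> y \<in> neighbours G u \<or> x \<in> neighbours G u \<and> z \<in> neighbours G u \<or>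
    y \<in> neighbours G u \<and> z \<in> neighbours G u"
proof -
  have "degree_into G {} u = 0" by (simp add: degree_into_def)
  then show ?thesis using assms by (simp add: degree_into_insert)
qed

end

context no_feasible_pair
begin

text \<open>Here \<open>A\<close> and \<open>B\<close> exclude the triangle. The point of this normalization is that any vertex of the
  triangle may play the role of \<open>x\<close>.\<close>

definition triangle_state :: "'a set \<Rightarrow> 'a set \<Rightarrow> 'a \<Rightarrow> 'a \<Rightarrow> 'a \<Rightarrow> bool" where
  "triangle_state A B x y z \<longleftrightarrow> extremal (insert x A) (insert y (insert z B)) \<and>
     distinct [x, y, z] \<and> {x, y, z} \<inter> (A \<union> B) = {} \<and>
     y \<in> neighbours G x \<and> z \<in> neighbours G x \<and> z \<in> neighbours G y \<and>
     degree_into G (insert x A) x < a x \<and>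
     degree_into G (insert y (insert z B)) y = b y \<and>
     degree_into G (insert y (insert z B)) z = b z"

lemma triangle_state_exists: "\<exists>A B x y z. triangle_state A B x y z"
proof -
  obtain A B where e: "extremal A B" using extremal_exists by blast
  then have r: "right_heavy A B" by (simp add: extremal_def)
  note p = extremal_partition[OF e]
  obtain y where y: "y \<in> B" "degree_into G B y = b y" using right_heavy_tight_vertex[OF r] by blast
  have yV: "y \<in> pverts G" using y p by auto
  \<comment> \<open>Positive demands keep both sides non-empty: \<open>y\<close> has
    \<open>a y\<close> neighbours in \<open>A\<close> and \<open>b y\<close> in
    \<open>B - {y}\<close>.\<close>
  have "degree_into G A y = a y" using right_heavy_move(2)[OF r] y by simp
  then have "A \<noteq> {}" using a_pos[OF yV] by (auto simp: degree_into_def)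
  then obtain x where x: "x \<in> A" "degree_into G A x < a x"
    using degenerateD[of G a A] r by (auto simp: right_heavy_def)
  have l: "left_heavy (insert y A) (B - {y})" by (rule extremal_move[OF e y])
  have "B - {y} \<noteq> {}"
  proof
    assume "B - {y} = {}"
    then have "degree_into G (B - {y}) y = 0" by (simp only: degree_into_def) simp
    then show False using y b_pos[OF yV] by simp
  qed
  \<comment> \<open>\<open>z\<close> is deficient only after \<open>y\<close> has left the feasible
    set \<open>B\<close>, hence it is a neighbour of \<open>y\<close> and was tight.\<close>
  then obtain z where z: "z \<in> B - {y}" "degree_into G (B - {y}) z < b z"
    using degenerateD[of G b "B - {y}"] l by (auto simp: left_heavy_def)
  moreover have "b z \<le> degree_into G B z"
    using right_heavy_feasible[OF r] z by (simp add: feasible_def)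
  ultimately have yz: "y \<in> neighbours G z" "degree_into G B z = b z"
    using degree_into_remove[OF y(1), of z] by (auto split: if_splits)
  have "x \<in> neighbours G y" "x \<in> neighbours G z"
    using extremal_deficient(1)[OF e x] y yz z by auto
  moreover have "insert x (A - {x}) = A" "insert y (insert z (B - {y, z})) = B"
    using x y z by auto
  moreover have "{x, y, z} \<inter> ((A - {x}) \<union> (B - {y, z})) = {}" "distinct [x, y, z]"
    using p x y z by auto
  ultimately have "triangle_state (A - {x}) (B - {y, z}) x y z"
    unfolding triangle_state_def using e x y yz neighbours_sym by auto
  then show ?thesis by blast
qed

lemma triangle_state_swap_right:
  "triangle_state A B x y z \<Longrightarrow> triangle_state A B x z y"
  unfolding triangle_state_def using neighbours_sym by (auto simp: insert_commute)

lemma triangle_state_partition: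
  "triangle_state A B x y z \<Longrightarrow> A \<inter> B = {} \<and> pverts G = A \<union> B \<union> {x, y, z}"
  using extremal_partition unfolding triangle_state_def by blast

text \<open>\<open>extremal_swap\<close> exchanges \<open>x\<close> and \<open>y\<close>. Together
  with \<open>triangle_state_swap_right\<close> this generates all permutations of the
  triangle.\<close>

lemma triangle_state_swap_left:
  assumes t: "triangle_state A B x y z"
  shows "triangle_state A B y x z"
proof -
  let ?A = "insert x A" and ?B = "insert y (insert z B)"
  have e: "extremal ?A ?B" and d: "distinct [x, y, z]" "{x, y, z} \<inter> (A \<union> B) = {}"
    and adj: "y \<in> neighbours G x" "z \<in> neighbours G x" "z \<in> neighbours G y"
    and x: "degree_into G ?A x < a x" and y: "degree_into G ?B y = b y" and z: "degree_into G ?B z = b z"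
    using t unfolding triangle_state_def by auto
  have adj': "x \<in> neighbours G y" "x \<in> neighbours G z" "y \<in> neighbours G z"
    using adj neighbours_sym by auto
  have r: "right_heavy ?A ?B" using e by (simp add: extremal_def)
  have "?A - {x} = A" "?B - {y} = insert z B" using d by auto
  then have e': "extremal (insert y A) (insert x (insert z B))"
    using extremal_swap[OF e _ x _ y] by simp
  have "degree_into G ?A y = a y" using right_heavy_move(2)[OF r] y by simp
  then have "degree_into G (insert y A) y < a y" using d adj' degree_into_insert[of x A y] by simp
  moreover have "degree_into G ?B x = Suc (b x)" using extremal_deficient(3)[OF e _ x _ y] by simp
  then have "degree_into G (insert x (insert z B)) x = b x"
    using d adj degree_into_insert[of y "insert z B" x] by simp
  moreover have "degree_into G (insert x (insert z B)) z = b z"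
    using z d adj' degree_into_insert[of y "insert z B" z] degree_into_insert[of x "insert z B" z] by simp
  ultimately show ?thesis
    unfolding triangle_state_def using e' d adj adj' by auto
qed

text \<open>For \<open>x\<close> the two parts contribute \<open>a x - 1\<close> and
  \<open>b x + 1\<close>; the other vertices follow by permuting the triangle.\<close>

lemma triangle_state_tight:
  assumes "triangle_state A B x y z"
  shows "degree_into G (pverts G) x = a x + b x" "degree_into G (pverts G) y = a y + b y"
    "degree_into G (pverts G) z = a z + b z"
proof -
  have *: "degree_into G (pverts G) x = a x + b x" if t: "triangle_state A B x y z" for x y z
  proof -
    let ?A = "insert x A" and ?B = "insert y (insert z B)"
    have e: "extremal ?A ?B" and x: "degree_into G ?A x < a x" and y: "degree_into G ?B y = b y"
      using t unfolding triangle_state_def by auto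
    show ?thesis
      using extremal_deficient(2,3)[OF e _ x _ y] degree_into_Un[of ?A ?B x] extremal_partition[OF e]
      by simp
  qed
  show "degree_into G (pverts G) x = a x + b x" by (rule *[OF assms])
  show "degree_into G (pverts G) y = a y + b y" by (rule *[OF triangle_state_swap_left[OF assms]])
  show "degree_into G (pverts G) z = a z + b z"
    by (rule *[OF triangle_state_swap_left[OF triangle_state_swap_right[OF assms]]])
qed

lemma triangle_state_feasible:
  assumes "triangle_state A B x y z"
  shows "B = {} \<Longrightarrow> feasible G b {y, z}" "A = {} \<Longrightarrow> feasible G a {x, y}"
    "degenerate G a A" "degenerate G b B"
proof -
  let ?A = "insert x A" and ?B = "insert y (insert z B)"
  have e: "extremal ?A ?B" and y: "degree_into G ?B y = b y" and d: "distinct [x, y, z]" "{x, y, z} \<inter> (A \<union> B) = {}"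
    using assms unfolding triangle_state_def by auto
  have r: "right_heavy ?A ?B" using e by (simp add: extremal_def)
  have l: "left_heavy (insert y ?A) (insert z B)"
  proof -
    have "?B - {y} = insert z B" using d by auto
    then show ?thesis using extremal_move[OF e _ y] by simp
  qed
  show "feasible G b {y, z}" if "B = {}" using right_heavy_feasible[OF r] that by simp
  show "feasible G a {x, y}" if "A = {}" using left_heavy_feasible[OF l] that by (simp add: insert_commute)
  show "degenerate G a A" using r degenerate_mono[of G a ?A A] by (auto simp: right_heavy_def)
  show "degenerate G b B" using l degenerate_mono[of G b "insert z B" B] by (auto simp: left_heavy_def)
qed

text \<open>If \<open>p\<close> misses \<open>x\<close>, it stays deficient in
  \<open>insert x A\<close> and is therefore adjacent to the tight vertices \<open>y\<close> and
  \<open>z\<close>. Since any triangle vertex can play \<open>x\<close>, \<open>p\<close> misses at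
  most one of them.\<close>

lemma triangle_state_deficient_left:
  assumes t: "triangle_state A B x y z" and p: "p \<in> A" "degree_into G A p < a p"
  shows "2 \<le> degree_into G {x, y, z} p"
proof -
  have *: "y \<in> neighbours G p \<and> z \<in> neighbours G p"
    if t: "triangle_state A B x y z" and n: "x \<notin> neighbours G p" for x y z
  proof -
    let ?A = "insert x A" and ?B = "insert y (insert z B)"
    have e: "extremal ?A ?B" and y: "degree_into G ?B y = b y" and z: "degree_into G ?B z = b z"
      and d: "x \<notin> A"
      using t unfolding triangle_state_def by auto
    have "degree_into G ?A p < a p" using p n d by (simp add: degree_into_insert)
    from extremal_deficient(1)[OF e _ this _ y] extremal_deficient(1)[OF e _ this _ z]
    show ?thesis using p neighbours_sym by auto
  qed
  have "distinct [x, y, z]" using t unfolding triangle_state_def by auto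
  then show ?thesis
    using *[OF t] *[OF triangle_state_swap_left[OF t]]
      *[OF triangle_state_swap_left[OF triangle_state_swap_right[OF t]]]
    unfolding degree_into_triple[OF \<open>distinct [x, y, z]\<close>] by blast
qed

lemma triangle_state_degree_right:
  assumes t: "triangle_state A B x y z" and q: "q \<in> B"
  shows "degree_into G (insert y (insert z B)) q = degree_into G B q
     + (if y \<in> neighbours G q then 1 else 0) + (if z \<in> neighbours G q then 1 else 0)"
    and "b q \<le> degree_into G (insert y (insert z B)) q"
proof -
  show "degree_into G (insert y (insert z B)) q = degree_into G B q
     + (if y \<in> neighbours G q then 1 else 0) + (if z \<in> neighbours G q then 1 else 0)"
    using t unfolding triangle_state_def by (auto simp: degree_into_insert)
  have "right_heavy (insert x A) (insert y (insert z B))"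
    using t by (simp add: triangle_state_def extremal_def)
  then show "b q \<le> degree_into G (insert y (insert z B)) q"
    using right_heavy_feasible q by (auto simp: feasible_def)
qed

text \<open>Feasibility of the right side gives \<open>q\<close> a neighbour among \<open>y\<close>
  and \<open>z\<close>. If it has only one, \<open>q\<close> is tight there and so adjacent to
  \<open>x\<close>.\<close>

lemma triangle_state_deficient_right:
  assumes t: "triangle_state A B x y z" and q: "q \<in> B" "degree_into G B q < b q"
  shows "2 \<le> degree_into G {x, y, z} q"
proof -
  let ?A = "insert x A" and ?B = "insert y (insert z B)"
  have e: "extremal ?A ?B" and x: "degree_into G ?A x < a x" and d: "distinct [x, y, z]"
    using t unfolding triangle_state_def by auto
  note g = triangle_state_degree_right[OF t q(1)]
  have "x \<in> neighbours G q" if "degree_into G ?B q = b q"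
    using extremal_deficient(1)[OF e _ x _ that] q by simp
  then show ?thesis using g q(2) unfolding degree_into_triple[OF d] by (auto split: if_splits)
qed

text \<open>Here \<open>p\<close> is still deficient in \<open>insert x A\<close> and
  \<open>q\<close> is tight on the right, so \<open>extremal_deficient\<close> applies to this pair
  too.\<close>

lemma triangle_state_deficient_adjacent:
  assumes t: "triangle_state A B x y z" and p: "p \<in> A" "degree_into G A p < a p" "x \<notin> neighbours G p"
    and q: "q \<in> B" "degree_into G B q < b q" "\<not> (y \<in> neighbours G q \<and> z \<in> neighbours G q)"
  shows "p \<in> neighbours G q"
proof -
  let ?A = "insert x A" and ?B = "insert y (insert z B)"
  have e: "extremal ?A ?B" and d: "x \<notin> A" using t unfolding triangle_state_def by auto
  have "degree_into G ?A p < a p" using p d by (simp add: degree_into_insert)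
  moreover have "degree_into G ?B q = b q"
    using triangle_state_degree_right[OF t q(1)] q by (auto split: if_splits)
  ultimately show ?thesis using extremal_deficient(1)[OF e] p(1) q(1) by simp
qed

section \<open>Completing the triangle to a forbidden subgraph in the two cases\<close>

lemma diamond_case:
  assumes five: "5 \<le> card (pverts G)"
    and diamond: "\<And>x y z u v. \<lbrakk>degree_into G (pverts G) x = a x + b x;
      distinct [x, y, z, u, v]; y \<in> neighbours G x; z \<in> neighbours G x; z \<in> neighbours G y;
      2 \<le> degree_into G {x, y, z} v; 2 \<le> degree_into G {x, y, z, v} u\<rbrakk> \<Longrightarrow> False"
  shows False
proof -
  obtain A B x y z where t: "triangle_state A B x y z" using triangle_state_exists by blast
  have adj: "y \<in> neighbours G x" "z \<in> neighbours G x" "z \<in> neighbours G y"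
    and d: "distinct [x, y, z]" "{x, y, z} \<inter> (A \<union> B) = {}"
    using t unfolding triangle_state_def by auto
  note part = triangle_state_partition[OF t]
  note feas = triangle_state_feasible[OF t]
  \<comment> \<open>\<open>v\<close> completes the triangle to a copy of
    \<open>K\<^sub>4 - e\<close>, and \<open>u\<close> is the additional vertex.\<close>
  have E: False if "u \<notin> {x, y, z, v}" "v \<notin> {x, y, z}" "2 \<le> degree_into G {x, y, z} v"
    "2 \<le> degree_into G {x, y, z, v} u" for u v
    using diamond[OF triangle_state_tight(1)[OF t], of y z u v] that adj d by auto
  have mono: "degree_into G {x, y, z} u \<le> degree_into G {x, y, z, v} u" for u v
    by (rule degree_into_mono) auto
  define D where "D = {v \<in> pverts G - {x, y, z}. 2 \<le> degree_into G {x, y, z} v}"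
  define C where "C = pverts G - {x, y, z} - D"
  have D_unique: "u = v" if "u \<in> D" "v \<in> D" for u v
    using E[of u v] mono[of u v] that unfolding D_def by auto
  have disj: "A = {} \<or> B = {}"
  proof (rule ccontr)
    assume "\<not> (A = {} \<or> B = {})"
    then obtain p q where p: "p \<in> A" "degree_into G A p < a p" and q: "q \<in> B" "degree_into G B q < b q"
      using degenerateD[OF feas(3)] degenerateD[OF feas(4)] by blast
    have "p \<in> D" "q \<in> D"
      using triangle_state_deficient_left[OF t p] triangle_state_deficient_right[OF t q] part d p q
      unfolding D_def by auto
    then show False using D_unique p q part by blast
  qed
  have "card D \<le> 1"
    using D_unique by (metis One_nat_def card_le_Suc0_iff_eq card.infinite le0)
  moreover have "card {x, y, z} \<le> 3" by (simp add: card_insert_if)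
  ultimately have "card ({x, y, z} \<union> D) < card (pverts G)"
    using card_Un_le[of "{x, y, z}" D] five by linarith
  moreover have finR: "finite ({x, y, z} \<union> D)"
    using pair_finite_verts unfolding D_def by auto
  \<comment> \<open>The triangle and \<open>D\<close> have at most four vertices together; this is
    where five vertices are required.\<close>
  ultimately have C_ne: "C \<noteq> {}"
    unfolding C_def using card_mono[OF finR, of "pverts G"] by (auto simp: subset_eq)
  have C_deg: "degree_into G (pverts G) u \<le> Suc (degree_into G C u)" if u: "u \<in> C" for u
  proof -
    have uD: "u \<in> pverts G" "u \<notin> {x, y, z}" "u \<notin> D" using u unfolding C_def by auto
    have "degree_into G ({x, y, z} \<union> D) u \<le> 1"
    proof (cases "D = {}")
      case True
      moreover have "degree_into G {x, y, z} u < 2" using uD unfolding D_def by auto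
      ultimately show ?thesis by simp
    next
      case False
      then obtain v where v: "v \<in> D" by blast
      then have "D = {v}" using D_unique by blast
      then have "{x, y, z} \<union> D = {x, y, z, v}" by auto
      moreover have "\<not> 2 \<le> degree_into G {x, y, z, v} u"
        using E[of u v] v uD unfolding D_def by auto
      ultimately show ?thesis by simp
    qed
    moreover have "pverts G = C \<union> ({x, y, z} \<union> D)" "C \<inter> ({x, y, z} \<union> D) = {}"
      unfolding C_def D_def using part by auto
    ultimately show ?thesis using degree_into_Un[of C "{x, y, z} \<union> D" u] by simp
  qed
  \<comment> \<open>A vertex of \<open>C\<close> loses at most one neighbour, and
    \<open>a u + b u - 1\<close> is at least \<open>a u\<close> and at least
    \<open>b u\<close>.\<close>
  have C_feas: "feasible G a C" "feasible G b C"
  proof -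
    have "a u \<le> degree_into G C u \<and> b u \<le> degree_into G C u" if "u \<in> C" for u
    proof -
      have "u \<in> pverts G" using that by (simp add: C_def)
      then show ?thesis using C_deg[OF that] degree_ge[of u] a_pos[of u] b_pos[of u] by linarith
    qed
    then show "feasible G a C" "feasible G b C" by (auto simp: feasible_def C_def)
  qed
  have CV: "C \<subseteq> pverts G" "C \<inter> {x, y, z} = {}" unfolding C_def by auto
  show False
  proof (cases "A = {}")
    case True
    have "degenerate G a {x, y} \<or> degenerate G b C" using CV part by (intro no_pair) auto
    then show False
      using feasible_not_degenerate[OF feas(2)[OF True]] feasible_not_degenerate[OF C_feas(2) C_ne] by auto
  next
    case False
    then have B: "B = {}" using disj by blast
    have "degenerate G a C \<or> degenerate G b {y, z}" using CV part by (intro no_pair) auto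
    then show False
      using feasible_not_degenerate[OF feas(1)[OF B]] feasible_not_degenerate[OF C_feas(1) C_ne] by auto
  qed
qed

text \<open>Demands of at least 2 on the triangle make \<open>A\<close> and \<open>B\<close>
  non-empty, so deficient vertices \<open>p\<close> and \<open>q\<close> exist. Both parts of each
  \<open>K\<^sub>{2,3}\<close> are then found among \<open>x\<close>, \<open>y\<close>,
  \<open>z\<close>, \<open>p\<close>, \<open>q\<close>.\<close>

lemma K23_case:
  assumes two: "\<And>u. \<lbrakk>u \<in> pverts G; degree_into G (pverts G) u = a u + b u\<rbrakk> \<Longrightarrow> 2 \<le> a u \<and> 2 \<le> b u"
    and K23: "\<And>s t c d e. \<lbrakk>degree_into G (pverts G) s = a s + b s; distinct [s, t, c, d, e];
      {c, d, e} \<subseteq> neighbours G s; {c, d, e} \<subseteq> neighbours G t\<rbrakk> \<Longrightarrow> False"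
  shows False
proof -
  \<comment> \<open>The parts are \<open>{y, z}\<close> and \<open>{x, p, q}\<close> if
    \<open>q\<close> is adjacent to \<open>y\<close> and \<open>z\<close>, and \<open>{x, p}\<close>
    and \<open>{y, z, q}\<close> otherwise.\<close>
  have *: False if t: "triangle_state A B x y z" and p: "p \<in> A" "degree_into G A p < a p"
    and q: "q \<in> B" "degree_into G B q < b q" and n: "x \<notin> neighbours G p" for A B x y z p q
  proof -
    have adj: "y \<in> neighbours G x" "z \<in> neighbours G x" "z \<in> neighbours G y"
      and d: "distinct [x, y, z]" "{x, y, z} \<inter> (A \<union> B) = {}"
      using t unfolding triangle_state_def by auto
    note tight = triangle_state_tight[OF t]
    have pq: "p \<noteq> q" "p \<notin> {x, y, z}" "q \<notin> {x, y, z}"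
      using p q d triangle_state_partition[OF t] by auto
    have pyz: "y \<in> neighbours G p" "z \<in> neighbours G p"
      using triangle_state_deficient_left[OF t p] n unfolding degree_into_triple[OF d(1)] by auto
    have nq: "\<not> (y \<in> neighbours G q \<and> z \<in> neighbours G q)"
      using K23[OF tight(2), of z x p q] adj d pq pyz neighbours_sym by auto
    then have "x \<in> neighbours G q"
      using triangle_state_deficient_right[OF t q] unfolding degree_into_triple[OF d(1)] by auto
    moreover have "p \<in> neighbours G q"
      by (rule triangle_state_deficient_adjacent[OF t p n q nq])
    ultimately show False
      using K23[OF tight(1), of p y z q] adj d pq pyz neighbours_sym by auto
  qed
  obtain A B x y z where t: "triangle_state A B x y z" using triangle_state_exists by blast
  have adj: "y \<in> neighbours G x" "z \<in> neighbours G x" "z \<in> neighbours G y"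
    and d: "distinct [x, y, z]" "{x, y, z} \<inter> (A \<union> B) = {}"
    and e: "extremal (insert x A) (insert y (insert z B))" and y: "degree_into G (insert y (insert z B)) y = b y"
    using t unfolding triangle_state_def by auto
  note tight = triangle_state_tight[OF t]
  note part = triangle_state_partition[OF t]
  have r: "right_heavy (insert x A) (insert y (insert z B))" using e by (simp add: extremal_def)
  have two_y: "2 \<le> a y" "2 \<le> b y" using two[of y] tight part by auto
  have deg0: "degree_into G {} u = 0" for u by (simp add: degree_into_def)
  have "degree_into G (insert x A) y = a y" using right_heavy_move(2)[OF r] y by simp
  then have "A \<noteq> {}" using two_y d deg0 by (auto simp: degree_into_insert split: if_splits)
  then obtain p where p: "p \<in> A" "degree_into G A p < a p"
    using degenerateD[OF triangle_state_feasible(3)[OF t]] by blast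
  have "B \<noteq> {}" using two_y d deg0 y by (auto simp: degree_into_insert split: if_splits)
  then obtain q where q: "q \<in> B" "degree_into G B q < b q"
    using degenerateD[OF triangle_state_feasible(4)[OF t]] by blast
  have pq: "p \<noteq> q" "p \<notin> {x, y, z}" "q \<notin> {x, y, z}"
    using p q d part by auto
  have "x \<in> neighbours G p" "y \<in> neighbours G p" "z \<in> neighbours G p"
    using *[OF t p q] *[OF triangle_state_swap_left[OF t] p q]
      *[OF triangle_state_swap_left[OF triangle_state_swap_right[OF t]] p q] by auto
  moreover have "2 \<le> degree_into G {x, y, z} q" by (rule triangle_state_deficient_right[OF t q])
  \<comment> \<open>Two neighbours of \<open>q\<close> in the triangle form one part; the third
    triangle vertex, \<open>p\<close> and \<open>q\<close> form the other.\<close>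
  ultimately show False
    using K23[OF tight(1), of y z p q] K23[OF tight(1), of z y p q] K23[OF tight(2), of z x p q]
      adj d pq neighbours_sym unfolding degree_into_triple[OF d(1)] by auto
qed

end

section \<open>Extending a feasible pair to a partition\<close>

context pair_graph
begin

text \<open>Take \<open>A\<close> of maximum size among the \<open>a\<close>-feasible sets avoiding
  \<open>Y\<close>. A vertex outside \<open>A\<close> and \<open>Y\<close> cannot be added, so it
  has fewer than \<open>a u\<close> neighbours in \<open>A\<close> and at least \<open>b u\<close>
  elsewhere.\<close>

lemma feasible_pair_extends:
  assumes deg: "\<And>u. u \<in> pverts G \<Longrightarrow> a u + b u \<le> degree_into G (pverts G) u"
    and X: "feasible G a X" "X \<noteq> {}" and Y: "feasible G b Y" "Y \<noteq> {}" and "X \<inter> Y = {}"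
  shows "\<exists>A B. feasible_partition G a b A B"
proof -
  let ?P = "\<lambda>A. feasible G a A \<and> A \<noteq> {} \<and> A \<inter> Y = {}"
  have "\<forall>A. ?P A \<longrightarrow> card A < Suc (card (pverts G))"
    by (auto simp: feasible_def less_Suc_eq_le intro: card_mono[OF pair_finite_verts])
  then obtain A where A: "?P A" and max: "\<And>A'. ?P A' \<Longrightarrow> card A' \<le> card A"
    using ex_has_greatest_nat[of ?P X card "Suc (card (pverts G))"] X \<open>X \<inter> Y = {}\<close> by auto
  let ?B = "pverts G - A"
  have AV: "A \<subseteq> pverts G" using A by (simp add: feasible_def)
  have YB: "Y \<subseteq> ?B" using A Y by (auto simp: feasible_def)
  have "b u \<le> degree_into G ?B u" if u: "u \<in> ?B" for u
  proof (cases "u \<in> Y")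
    case True
    then have "b u \<le> degree_into G Y u" using Y by (simp add: feasible_def)
    also have "\<dots> \<le> degree_into G ?B u" by (rule degree_into_mono[OF YB])
    finally show ?thesis .
  next
    case False
    have "finite A" using AV pair_finite_verts by (rule finite_subset)
    then have "\<not> ?P (insert u A)" using max[of "insert u A"] u by auto
    then have "\<not> feasible G a (insert u A)" using A False by auto
    moreover have "a v \<le> degree_into G (insert u A) v" if "v \<in> A" for v
    proof -
      have "a v \<le> degree_into G A v" using A that by (simp add: feasible_def)
      also have "\<dots> \<le> degree_into G (insert u A) v" by (rule degree_into_mono) auto
      finally show ?thesis .
    qed
    ultimately have "degree_into G A u < a u" using AV u by (auto simp: feasible_def)
    moreover have "A \<union> ?B = pverts G" using AV by auto
    then have "degree_into G (pverts G) u = degree_into G A u + degree_into G ?B u"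
      using degree_into_Un[of A ?B u] by simp
    ultimately show ?thesis using deg[of u] u by simp
  qed
  then have "feasible G b ?B" by (simp add: feasible_def)
  then have "feasible_partition G a b A ?B"
    unfolding feasible_partition_def using A AV YB Y(2) by auto
  then show ?thesis by blast
qed

end

section \<open>Copies of the prescribed graphs\<close>

context pair_graph
begin

text \<open>The copy is the image of \<open>H\<close>. Arcs need only be preserved, not reflected,
  since copies may be non-induced.\<close>

lemma T1_embedding:
  assumes H: "H \<in> \<H>" "pair_wf_digraph H" "inj_on \<phi> (pverts H)"
    and verts: "\<phi> ` pverts H \<subseteq> pverts G"
    and arcs: "\<And>i j. (i, j) \<in> parcs H \<Longrightarrow> (\<phi> i, \<phi> j) \<in> parcs G"
    and i: "i \<in> pverts H"
  shows "\<phi> i \<in> T1 \<H> G"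
proof -
  interpret H: pair_wf_digraph H by fact
  define S where "S = \<lparr>pverts = \<phi> ` pverts H, parcs = map_prod \<phi> \<phi> ` parcs H\<rparr>"
  have wfS: "pair_wf_digraph S"
    by unfold_locales (auto simp: S_def dest: H.wellformed')
  have "subgraph (with_proj S) (with_proj G)"
    unfolding subgraph_def compatible_def
    using verts arcs wfS pair_wf_digraph_axioms
    by (auto simp: wf_digraph_wp_iff S_def intro: wf_digraph_axioms)
  moreover have "digraph_iso (with_proj H) (with_proj S)"
  proof -
    let ?f = "\<lparr>iso_verts = \<phi>, iso_arcs = map_prod \<phi> \<phi>, iso_head = snd, iso_tail = fst\<rparr>"
    have "inj_on (map_prod \<phi> \<phi>) (parcs H)"
      using map_prod_inj_on[OF H(3) H(3)] by (rule inj_on_subset) (auto dest: H.wellformed')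
    then have "pre_digraph.digraph_isomorphism (with_proj H) ?f"
      unfolding pre_digraph.digraph_isomorphism_def using H(2,3) by (simp add: wf_digraph_wp_iff)
    moreover have "with_proj S = app_iso ?f (with_proj H)"
      by (simp add: app_iso_def S_def with_proj_def)
    ultimately show ?thesis unfolding digraph_iso_def by blast
  qed
  ultimately show ?thesis
    unfolding T1_def using H(1) i verts by (auto simp: S_def intro!: exI[of _ S] bexI[of _ H])
qed

lemma T1_K23:
  assumes H: "complete_bipartite_digraph 2 3 (with_proj H)" "H \<in> \<H>"
    and d: "distinct [s, t, c, d, e]"
    and n: "{c, d, e} \<subseteq> neighbours G s" "{c, d, e} \<subseteq> neighbours G t"
  shows "s \<in> T1 \<H> G"
proof -
  obtain U V where UV: "pverts H = U \<union> V" "U \<inter> V = {}" "card U = 2" "card V = 3"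
    "parcs H = U \<times> V \<union> V \<times> U"
    using H(1) unfolding complete_bipartite_digraph_pair_def by auto
  obtain u1 u2 where U: "U = {u1, u2}" "u1 \<noteq> u2" using UV(3) by (auto simp: card_2_iff)
  obtain v1 v2 v3 where V: "V = {v1, v2, v3}" "v1 \<noteq> v2" "v1 \<noteq> v3" "v2 \<noteq> v3"
    using UV(4) by (auto simp: card_3_iff)
  define \<phi> where "\<phi> i = (if i = u1 then s else if i = u2 then t else if i = v1 then c
    else if i = v2 then d else e)" for i
  have ne: "u1 \<noteq> v1" "u1 \<noteq> v2" "u1 \<noteq> v3" "u2 \<noteq> v1" "u2 \<noteq> v2" "u2 \<noteq> v3"
    using UV(2) U V by auto
  have val: "\<phi> u1 = s" "\<phi> u2 = t" "\<phi> v1 = c" "\<phi> v2 = d" "\<phi> v3 = e"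
    using ne U V by (auto simp: \<phi>_def)
  have arcs: "(s, c) \<in> parcs G" "(s, d) \<in> parcs G" "(s, e) \<in> parcs G"
    "(t, c) \<in> parcs G" "(t, d) \<in> parcs G" "(t, e) \<in> parcs G"
    "(c, s) \<in> parcs G" "(d, s) \<in> parcs G" "(e, s) \<in> parcs G"
    "(c, t) \<in> parcs G" "(d, t) \<in> parcs G" "(e, t) \<in> parcs G"
    using n neighbours_sym by (auto simp: neighbours_def)
  have "\<phi> u1 \<in> T1 \<H> G"
  proof (rule T1_embedding[OF H(2)])
    show "pair_wf_digraph H" by unfold_locales (auto simp: UV)
    show "inj_on \<phi> (pverts H)" using d by (auto simp: UV U V val inj_on_def)
    show "\<phi> ` pverts H \<subseteq> pverts G"
      using arcs by (auto simp: UV U V val dest: in_arcsD1)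
    show "(\<phi> i, \<phi> j) \<in> parcs G" if "(i, j) \<in> parcs H" for i j
      using that arcs by (auto simp: UV U V val)
    show "u1 \<in> pverts H" by (simp add: UV U)
  qed
  then show ?thesis by (simp add: val)
qed

text \<open>\<open>c\<close> and \<open>e\<close> have degree three in \<open>K\<^sub>4 - e\<close>,
  while \<open>f\<close> and \<open>g\<close> are the ends of the deleted edge and may be adjacent
  in \<open>G\<close>.\<close>

lemma T1_diamond_plus_vertex:
  assumes d: "distinct [c, e, f, g, u]"
    and n: "{e, f, g} \<subseteq> neighbours G c" "{f, g} \<subseteq> neighbours G e"
    and u: "2 \<le> degree_into G {c, e, f, g} u"
  shows "{c, e, f} \<subseteq> T1 {H. is_K4_minus_edge_plus_vertex H} G"
proof -
  define \<phi> where "\<phi> i = (if i = 0 then c else if i = 1 then e else if i = 2 then f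
    else if i = 3 then g else u)" for i :: nat
  define K where "K = \<lparr>pverts = {0, 1, 2, 3 :: nat}, parcs = {(i, j). i \<in> {0, 1, 2, 3} \<and> j \<in> {0, 1, 2, 3} \<and> i \<noteq> j}\<rparr>"
  define D where "D = \<lparr>pverts = pverts K, parcs = parcs K - {(2, 3), (3, 2)}\<rparr>"
  have "complete_digraph 4 (with_proj K)"
    unfolding complete_digraph_pair_def by (auto simp: K_def)
  moreover have "(2, 3) \<in> parcs K" by (auto simp: K_def)
  ultimately have D: "is_K4_minus_edge D"
    unfolding is_K4_minus_edge_def D_def by blast
  have val: "\<phi> 0 = c" "\<phi> 1 = e" "\<phi> (Suc 0) = e" "\<phi> 2 = f" "\<phi> 3 = g" "\<phi> 4 = u" by (simp_all add: \<phi>_def)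
  \<comment> \<open>Which graph \<open>H\<close> arises depends on the two neighbours of
    \<open>u\<close>, so these are located before \<open>H\<close> is defined.\<close>
  obtain y z where yz: "y \<in> {0, 1, 2, 3}" "z \<in> {0, 1, 2, 3}" "y \<noteq> z"
    "\<phi> y \<in> neighbours G u" "\<phi> z \<in> neighbours G u"
  proof -
    have "\<not> card (neighbours G u \<inter> {c, e, f, g}) \<le> Suc 0" using u by (simp add: degree_into_def)
    then obtain s t where st: "s \<in> neighbours G u \<inter> {c, e, f, g}" "t \<in> neighbours G u \<inter> {c, e, f, g}" "s \<noteq> t"
      by (subst (asm) card_le_Suc0_iff_eq) auto
    have im: "{c, e, f, g} = \<phi> ` {0, 1, 2, 3}" by (simp add: val)
    have "s \<in> \<phi> ` {0, 1, 2, 3}" "t \<in> \<phi> ` {0, 1, 2, 3}" using st unfolding im by simp_all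
    then obtain y z where "y \<in> {0, 1, 2, 3}" "s = \<phi> y" "z \<in> {0, 1, 2, 3}" "t = \<phi> z"
      by (elim imageE)
    then show ?thesis using st by (intro that[of y z]) auto
  qed
  define H where "H = \<lparr>pverts = insert 4 (pverts D),
    parcs = parcs D \<union> {(4, y), (y, 4), (4, z), (z, 4)}\<rparr>"
  have "4 \<notin> pverts D" "y \<in> pverts D" "z \<in> pverts D" using yz by (auto simp: D_def K_def)
  then have "is_K4_minus_edge_plus_vertex H"
    unfolding is_K4_minus_edge_plus_vertex_def H_def using D yz(3) by blast
  then have HH: "H \<in> {H. is_K4_minus_edge_plus_vertex H}" by simp
  have Hv: "pverts H = {0, 1, 2, 3, 4}" by (auto simp: H_def D_def K_def)
  have D_arcs: "parcs D = {(0, 1), (1, 0), (0, 2), (2, 0), (0, 3), (3, 0), (1, 2), (2, 1), (1, 3), (3, 1)}"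
    by (auto simp: D_def K_def)
  have arcs: "(c, e) \<in> parcs G" "(c, f) \<in> parcs G" "(c, g) \<in> parcs G"
    "(e, f) \<in> parcs G" "(e, g) \<in> parcs G"
    "(e, c) \<in> parcs G" "(f, c) \<in> parcs G" "(g, c) \<in> parcs G"
    "(f, e) \<in> parcs G" "(g, e) \<in> parcs G"
    using n neighbours_sym by (auto simp: neighbours_def)
  have uarcs: "(u, \<phi> y) \<in> parcs G" "(u, \<phi> z) \<in> parcs G" "(\<phi> y, u) \<in> parcs G" "(\<phi> z, u) \<in> parcs G"
    using yz(4,5) neighbours_sym by (auto simp: neighbours_def)
  have T: "\<phi> i \<in> T1 {H. is_K4_minus_edge_plus_vertex H} G" if i: "i \<in> pverts H" for i
  proof (rule T1_embedding[OF HH _ _ _ _ i])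
    have "parcs H \<subseteq> pverts H \<times> pverts H"
      using \<open>y \<in> pverts D\<close> \<open>z \<in> pverts D\<close> D_arcs by (auto simp: H_def D_def K_def)
    then show "pair_wf_digraph H"
      by unfold_locales auto
    show "inj_on \<phi> (pverts H)" using d by (auto simp: Hv val inj_on_def)
    show "\<phi> ` pverts H \<subseteq> pverts G"
      using arcs uarcs by (auto simp: Hv val dest: in_arcsD1)
    show "(\<phi> i, \<phi> j) \<in> parcs G" if "(i, j) \<in> parcs H" for i j
    proof -
      have "(i, j) \<in> parcs D \<or> (i, j) \<in> {(4, y), (y, 4), (4, z), (z, 4)}"
        using that by (auto simp: H_def)
      then show ?thesis
      proof
        assume "(i, j) \<in> parcs D"
        then show ?thesis using arcs unfolding D_arcs by (auto simp: val)
      next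
        assume "(i, j) \<in> {(4, y), (y, 4), (4, z), (z, 4)}"
        then show ?thesis using uarcs by (auto simp: val)
      qed
    qed
  qed
  show ?thesis using T[of 0] T[of 1] T[of 2] by (simp add: Hv val)
qed

text \<open>Two triangle vertices adjacent to \<open>v\<close> serve as \<open>c\<close> and
  \<open>e\<close>, the third as \<open>f\<close>, and \<open>v\<close> as \<open>g\<close>.\<close>

lemma T1_triangle_diamond:
  assumes d: "distinct [x, y, z, u, v]"
    and n: "y \<in> neighbours G x" "z \<in> neighbours G x" "z \<in> neighbours G y"
    and v: "2 \<le> degree_into G {x, y, z} v" and u: "2 \<le> degree_into G {x, y, z, v} u"
  shows "x \<in> T1 {H. is_K4_minus_edge_plus_vertex H} G"
proof -
  have n': "x \<in> neighbours G y" "x \<in> neighbours G z" "y \<in> neighbours G z"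
    using n neighbours_sym by auto
  have dt: "distinct [x, y, z]" using d by auto
  consider "x \<in> neighbours G v" "y \<in> neighbours G v" | "x \<in> neighbours G v" "z \<in> neighbours G v"
    | "y \<in> neighbours G v" "z \<in> neighbours G v"
    using v unfolding degree_into_triple[OF dt] by blast
  then show ?thesis
  proof cases
    case 1
    then show ?thesis
      using T1_diamond_plus_vertex[of x y z v u] d n n' u neighbours_sym[of _ v] by auto
  next
    case 2
    moreover have "{x, z, y, v} = {x, y, z, v}" by auto
    ultimately show ?thesis
      using T1_diamond_plus_vertex[of x z y v u] d n n' u neighbours_sym[of _ v] by auto
  next
    case 3
    moreover have "{y, z, x, v} = {x, y, z, v}" by auto
    ultimately show ?thesis
      using T1_diamond_plus_vertex[of y z x v u] d n n' u neighbours_sym[of _ v] by auto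
  qed
qed

end

theorem theorem1p1:
  fixes G :: "'a pair_pre_digraph"
    and \<H> :: "nat pair_pre_digraph set"
    and a b h :: "'a \<Rightarrow> nat"
  assumes G: "pair_graph G"
    and five: "card (pverts G) \<ge> 5"
    and h: "\<forall>u\<in>pverts G. (h u = 0 \<and> u \<in> T0 \<H> G) \<or> (h u = 1 \<and> u \<in> T1 \<H> G)"
    and deg: "\<forall>u\<in>pverts G. out_degree (with_proj G) u \<ge> a u + b u + h u"
    and cases:
      "((\<forall>u\<in>pverts G. min (a u) (b u) \<ge> 1 - h u) \<and> \<H> = {H. is_K4_minus_edge_plus_vertex H}) \<or>
       ((\<forall>u\<in>pverts G. min (a u) (b u) \<ge> 2 - h u) \<and>
          (\<exists>H. complete_bipartite_digraph 2 3 (with_proj H) \<and> \<H> = {H}))"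
  shows "\<exists>A B. feasible_partition G a b A B"
proof (rule ccontr)
  assume no: "\<nexists>A B. feasible_partition G a b A B"
  interpret pair_graph G by (rule G)
  have dV: "a u + b u + h u \<le> degree_into G (pverts G) u" if "u \<in> pverts G" for u
  proof -
    have "neighbours G u \<inter> pverts G = neighbours G u" using neighbours_subset by auto
    then show ?thesis using deg that by (auto simp: degree_into_def out_degree_eq_card_neighbours)
  qed
  have dV': "a u + b u \<le> degree_into G (pverts G) u" if "u \<in> pverts G" for u
    using dV[OF that] by simp
  have no_feas: False if "feasible G a X" "X \<noteq> {}" "feasible G b Y" "Y \<noteq> {}" "X \<inter> Y = {}" for X Y
    using feasible_pair_extends[of a b, OF dV' that] no by simp
  have np: "degenerate G a X \<or> degenerate G b Y"
    if XY: "X \<subseteq> pverts G" "Y \<subseteq> pverts G" "X \<inter> Y = {}" for X Y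
  proof (rule ccontr)
    assume n: "\<not> (degenerate G a X \<or> degenerate G b Y)"
    obtain X' where X': "X' \<subseteq> X" "X' \<noteq> {}" "feasible G a X'"
      using not_degenerate_feasible[of G a X] n XY(1) by auto
    obtain Y' where Y': "Y' \<subseteq> Y" "Y' \<noteq> {}" "feasible G b Y'"
      using not_degenerate_feasible[of G b Y] n XY(2) by auto
    show False using no_feas[OF X'(3,2) Y'(3,2)] X'(1) Y'(1) XY(3) by blast
  qed
  have low: "1 \<le> a u + h u \<and> 1 \<le> b u + h u" if "u \<in> pverts G" for u
    using cases that by force
  \<comment> \<open>By \<open>low\<close>, every degree exceeds each single demand, so one vertex
    can be spared. A vertex of demand 0 would then form a feasible pair with the rest.\<close>
  have rest: "feasible G a (pverts G - {u}) \<and> feasible G b (pverts G - {u}) \<and> pverts G - {u} \<noteq> {}"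
    if u: "u \<in> pverts G" for u
  proof -
    have "a v \<le> degree_into G (pverts G - {u}) v \<and> b v \<le> degree_into G (pverts G - {u}) v"
      if "v \<in> pverts G - {u}" for v
      using degree_into_remove[OF u, of v] dV[of v] low[of v] that by (auto split: if_splits)
    moreover have "card (pverts G - {u}) \<noteq> 0" using five u by simp
    then have "pverts G - {u} \<noteq> {}" by (metis card.empty)
    ultimately show ?thesis by (simp add: feasible_def)
  qed
  have pos: "1 \<le> a u \<and> 1 \<le> b u" if u: "u \<in> pverts G" for u
  proof -
    have "feasible G f {u}" if "f u = 0" for f using u that by (simp add: feasible_def)
    then have "a u \<noteq> 0" "b u \<noteq> 0"
      using no_feas[of "{u}" "pverts G - {u}"] no_feas[of "pverts G - {u}" "{u}"] rest[OF u] by auto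
    then show ?thesis by simp
  qed
  interpret no_feasible_pair G a b
    using np pos dV' five by unfold_locales auto
  have tight: "u \<notin> T1 \<H> G \<and> h u = 0"
    if "degree_into G (pverts G) u = a u + b u" "u \<in> pverts G" for u
    using dV[of u] h that by (auto simp: T0_def)
  from cases show False
  proof
    assume "(\<forall>u\<in>pverts G. min (a u) (b u) \<ge> 1 - h u) \<and> \<H> = {H. is_K4_minus_edge_plus_vertex H}"
    then have \<H>: "\<H> = {H. is_K4_minus_edge_plus_vertex H}" by blast
    show False
    proof (rule diamond_case[OF five])
      fix x y z u v
      assume x: "degree_into G (pverts G) x = a x + b x" and d: "distinct [x, y, z, u, v]"
        and n: "y \<in> neighbours G x" "z \<in> neighbours G x" "z \<in> neighbours G y"
        and uv: "2 \<le> degree_into G {x, y, z} v" "2 \<le> degree_into G {x, y, z, v} u"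
      have "x \<in> T1 \<H> G" using T1_triangle_diamond[OF d n uv] \<H> by simp
      then show False using tight[OF x] by (auto simp: T1_def)
    qed
  next
    assume "(\<forall>u\<in>pverts G. min (a u) (b u) \<ge> 2 - h u) \<and>
          (\<exists>H. complete_bipartite_digraph 2 3 (with_proj H) \<and> \<H> = {H})"
    then obtain H where two: "\<forall>u\<in>pverts G. min (a u) (b u) \<ge> 2 - h u"
      and H: "complete_bipartite_digraph 2 3 (with_proj H)" "H \<in> \<H>" by blast
    show False
    proof (rule K23_case)
      \<comment> \<open>Tightness gives \<open>h u = 0\<close>, so the lower bound
        \<open>2 - h u\<close> is 2.\<close>
      show "2 \<le> a u \<and> 2 \<le> b u"
        if "u \<in> pverts G" "degree_into G (pverts G) u = a u + b u" for u
        using two tight that by fastforce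
    next
      fix s t c d e
      assume s: "degree_into G (pverts G) s = a s + b s" and d: "distinct [s, t, c, d, e]"
        and n: "{c, d, e} \<subseteq> neighbours G s" "{c, d, e} \<subseteq> neighbours G t"
      have "s \<in> T1 \<H> G" by (rule T1_K23[OF H d n])
      then show False using tight[OF s] by (auto simp: T1_def)
    qed
  qed
qed

end
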